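(* Let $n\le m$ be positive integers with $n\mid m$. Then for each integer $k$ with $\frac{m}{n}\le k\le m$ there exist states $\rho\in\mathcal{C}(\frac1n I_n,\frac1m I_m)$ with $\mathrm{rank}\,\rho=k$.
   Context: A state (density operator) is a positive semidefinite operator of trace $1$ on a finite-dimensional complex Hilbert space. $\mathcal{C}(\frac1n I_n,\frac1m I_m)$ is the set of states $\rho$ on $\mathbb{C}^n\otimes\mathbb{C}^m$ with $\mathrm{tr}_B(\rho)=\frac1n I_n$ and $\mathrm{tr}_A(\rho)=\frac1m I_m$, where $\mathrm{tr}_A$ is the partial trace over the first factor $\mathbb{C}^n$, $\mathrm{tr}_B$ is the partial trace over the second factor $\mathbb{C}^m$, and $I_n$ is the $n\times n$ identity. *)

theory Defs
  imports "HOL-Analysis.Analysis" "HOL-Library.Complex_Order"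
begin

text \<open>
  Operators on a finite-dimensional space with a fixed orthonormal basis indexed by a finite
  type are square complex matrices; the tensor product of the spaces indexed by
  \<open>'n\<close> and \<open>'m\<close> has its product basis indexed by \<open>'n \<times> 'm\<close>.
\<close>

text \<open>
  The order on \<^typ>\<open>complex\<close> is the one of \<^theory>\<open>HOL-Library.Complex_Order\<close>:
  \<open>0 \<le> z\<close> says that \<open>z\<close> is real and nonnegative. Over the complex numbers this forces
  the matrix to be Hermitian.
\<close>

definition positive_semidefinite :: "complex^'i^'i \<Rightarrow> bool" where
  "positive_semidefinite A \<longleftrightarrow> (\<forall>v. 0 \<le> (\<Sum>i\<in>UNIV. cnj (v $ i) * (A *v v) $ i))"

definition density_operator :: "complex^'i^'i \<Rightarrow> bool" where
  "density_operator \<rho> \<longleftrightarrow> positive_semidefinite \<rho> \<and> trace \<rho> = 1"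

definition partial_trace_A :: "complex^('n::finite \<times> 'm::finite)^('n \<times> 'm) \<Rightarrow> complex^'m^'m" where
  "partial_trace_A \<rho> = (\<chi> j l. \<Sum>i\<in>UNIV. \<rho> $ (i, j) $ (i, l))"

definition partial_trace_B :: "complex^('n::finite \<times> 'm::finite)^('n \<times> 'm) \<Rightarrow> complex^'n^'n" where
  "partial_trace_B \<rho> = (\<chi> i k. \<Sum>j\<in>UNIV. \<rho> $ (i, j) $ (k, j))"

definition couplings ::
    "complex^'n^'n \<Rightarrow> complex^'m^'m \<Rightarrow> (complex^('n::finite \<times> 'm::finite)^('n \<times> 'm)) set" where
  "couplings \<sigma> \<tau> =
    {\<rho>. density_operator \<rho> \<and> partial_trace_B \<rho> = \<sigma> \<and> partial_trace_A \<rho> = \<tau>}"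

definition maximally_mixed :: "complex^'i^'i" where
  "maximally_mixed = (1 / real CARD('i)) *\<^sub>R mat 1"

end

theory Submission
  imports Defs
begin

text \<open>
  Suppose each basis vector \<open>|j\<rangle>\<close> of the second factor carries a label \<open>a j\<close> from the basis of
  the first factor and a class \<open>c j\<close>, and put \<open>\<psi> s = (\<Sum>j | c j = s. |a j\<rangle> \<otimes> |j\<rangle>)\<close>. These
  vectors have disjoint supports, so the normalised sum of the projections \<open>|\<psi> s\<rangle>\<langle>\<psi> s|\<close> has rank
  the number of classes. Its first marginal is maximally mixed when all fibres of \<open>a\<close> have the
  same size, and its second one is when \<open>j \<mapsto> (a j, c j)\<close> is injective. If \<open>m = n d\<close> and
  \<open>d \<le> k \<le> m\<close>, then numbering the \<open>j\<close> from \<open>0\<close> to \<open>m - 1\<close> and taking \<open>a j = j div d\<close> and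
  \<open>c j = j mod k\<close> meets both conditions, with exactly \<open>k\<close> classes.
\<close>

section \<open>The state of a labelling: positivity, marginals and rank\<close>

definition class_state ::
    "('m \<Rightarrow> 'n) \<Rightarrow> ('m \<Rightarrow> 's) \<Rightarrow> complex^('n::finite \<times> 'm::finite)^('n \<times> 'm)" where
  "class_state a c = (\<chi> p q. if fst p = a (snd p) \<and> fst q = a (snd q) \<and> c (snd p) = c (snd q)
     then 1 / of_nat CARD('m) else 0)"

lemma maximally_mixed_component:
  "(maximally_mixed :: complex^'i^'i) $ p $ q = (if p = q then 1 / of_nat CARD('i) else 0)"
  by (simp add: maximally_mixed_def mat_def scaleR_conv_of_real [where 'a = complex])

lemma cnj_mult_self_nonneg: "0 \<le> cnj z * z"
  by (simp add: less_eq_complex_def)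

text \<open>The quadratic form at \<open>v\<close> equals \<open>t\<close> times the sum of the
  squared moduli of the inner products \<open>y s\<close> of \<open>x s\<close> with
  \<open>v\<close>.\<close>

lemma positive_semidefinite_weighted_gram:
  fixes A :: "complex^'i^'i" and x :: "'s \<Rightarrow> 'i \<Rightarrow> complex"
  assumes "0 \<le> t" and A: "\<And>p q. A $ p $ q = t * (\<Sum>s\<in>S. x s p * cnj (x s q))"
  shows "positive_semidefinite A"
  unfolding positive_semidefinite_def
proof
  fix v :: "complex^'i"
  define y where "y s = (\<Sum>q\<in>UNIV. cnj (x s q) * v $ q)" for s
  have Av: "(A *v v) $ p = t * (\<Sum>s\<in>S. x s p * y s)" for p
  proof -
    have "(A *v v) $ p = (\<Sum>q\<in>UNIV. \<Sum>s\<in>S. t * (x s p * (cnj (x s q) * v $ q)))"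
      by (simp add: matrix_vector_mult_def A sum_distrib_left sum_distrib_right mult_ac)
    also have "\<dots> = (\<Sum>s\<in>S. \<Sum>q\<in>UNIV. t * (x s p * (cnj (x s q) * v $ q)))"
      by (rule sum.swap)
    finally show ?thesis
      by (simp add: y_def sum_distrib_left)
  qed
  have "(\<Sum>p\<in>UNIV. cnj (v $ p) * (A *v v) $ p)
      = (\<Sum>p\<in>UNIV. \<Sum>s\<in>S. t * (x s p * cnj (v $ p) * y s))"
    by (simp add: Av sum_distrib_left mult_ac)
  also have "\<dots> = (\<Sum>s\<in>S. \<Sum>p\<in>UNIV. t * (x s p * cnj (v $ p) * y s))"
    by (rule sum.swap)
  also have "\<dots> = t * (\<Sum>s\<in>S. cnj (y s) * y s)"
    by (simp add: y_def sum_distrib_left sum_distrib_right mult_ac)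
  finally show "0 \<le> (\<Sum>p\<in>UNIV. cnj (v $ p) * (A *v v) $ p)"
    using \<open>0 \<le> t\<close> by (simp add: cnj_mult_self_nonneg sum_nonneg)
qed

lemma positive_semidefinite_class_state:
  fixes a :: "'m::finite \<Rightarrow> 'n::finite" and c :: "'m \<Rightarrow> 's"
  shows "positive_semidefinite (class_state a c)"
proof (rule positive_semidefinite_weighted_gram)
  let ?x = "\<lambda>s p. of_bool (fst p = a (snd p) \<and> c (snd p) = s) :: complex"
  show "0 \<le> (1 / of_nat CARD('m) :: complex)"
    by (simp add: less_eq_complex_def Re_divide_of_nat)
  show "class_state a c $ p $ q = 1 / of_nat CARD('m) * (\<Sum>s\<in>range c. ?x s p * cnj (?x s q))"
    for p q
  proof -
    \<comment> \<open>Written with a single test on \<open>s\<close>, the sum collapses to the term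
      \<open>s = c (snd p)\<close>, which always lies in \<open>range c\<close>.\<close>
    have "(\<Sum>s\<in>range c. ?x s p * cnj (?x s q))
        = (\<Sum>s\<in>range c. if c (snd p) = s
             then of_bool (fst p = a (snd p) \<and> fst q = a (snd q) \<and> c (snd q) = s) else 0)"
      by (intro sum.cong) auto
    then show ?thesis
      by (auto simp: class_state_def)
  qed
qed

lemma trace_class_state:
  fixes a :: "'m::finite \<Rightarrow> 'n::finite"
  shows "trace (class_state a c) = 1"
proof -
  \<comment> \<open>With the sum over \<open>i\<close> inside, each \<open>j\<close> contributes 1/m
    exactly once, at \<open>i = a j\<close>.\<close>
  have "trace (class_state a c) = (\<Sum>j\<in>UNIV. \<Sum>i\<in>UNIV. class_state a c $ (i, j) $ (i, j))"
    unfolding trace_def sum.cartesian_product' [where A = UNIV and B = UNIV, unfolded UNIV_Times_UNIV]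
    by (rule sum.swap)
  then show ?thesis
    by (simp add: class_state_def)
qed

text \<open>Off the diagonal a nonzero summand would need \<open>a j\<close> to equal both indices;
  on it, the fibre of \<open>a\<close> over \<open>i\<close> is counted with weight 1/m.\<close>

lemma partial_trace_B_class_state:
  fixes a :: "'m::finite \<Rightarrow> 'n::finite"
  assumes "\<And>i. CARD('n) * card {j. a j = i} = CARD('m)"
  shows "partial_trace_B (class_state a c) = maximally_mixed"
proof -
  have "(\<Sum>j\<in>UNIV. class_state a c $ (i, j) $ (i', j)) = maximally_mixed $ i $ i'" for i i'
  proof (cases "i = i'")
    case True
    have "(\<Sum>j\<in>UNIV. class_state a c $ (i, j) $ (i, j))
        = of_nat (card {j. a j = i}) / of_nat CARD('m)"
      by (simp add: class_state_def sum.If_cases eq_commute)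
    also have "\<dots> = 1 / of_nat CARD('n)"
    proof -
      have "of_nat (card {j. a j = i}) * of_nat CARD('n) = (of_nat CARD('m) :: complex)"
        by (metis assms mult.commute of_nat_mult)
      then show ?thesis
        by (simp add: field_simps)
    qed
    finally show ?thesis
      using True by (simp add: maximally_mixed_component)
  qed (auto simp: class_state_def maximally_mixed_component intro!: sum.neutral)
  then show ?thesis
    by (simp add: partial_trace_B_def vec_eq_iff)
qed

text \<open>A nonzero summand at \<open>(j, l)\<close> needs \<open>i = a j = a l\<close> and
  \<open>c j = c l\<close>. Injectivity then leaves only \<open>j = l\<close>, with the single index
  \<open>i = a j\<close>.\<close>

lemma partial_trace_A_class_state:
  fixes a :: "'m::finite \<Rightarrow> 'n::finite"
  assumes "inj (\<lambda>j. (a j, c j))"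
  shows "partial_trace_A (class_state a c) = maximally_mixed"
proof -
  have "(\<Sum>i\<in>UNIV. class_state a c $ (i, j) $ (i, l)) = maximally_mixed $ j $ l" for j l
  proof (cases "j = l")
    case True
    then show ?thesis
      by (simp add: class_state_def maximally_mixed_component)
  next
    case False
    then have "\<not> (a j = a l \<and> c j = c l)"
      using assms by (auto dest: injD)
    with False show ?thesis
      by (auto simp: class_state_def maximally_mixed_component intro!: sum.neutral)
  qed
  then show ?thesis
    by (simp add: partial_trace_A_def vec_eq_iff)
qed

text \<open>The nonzero rows are the vectors \<open>u s\<close> for the occurring classes
  \<open>s\<close>, that is, \<psi> s divided by m. Having disjoint supports, they form a basis of
  the row space.\<close>

lemma rank_class_state:
  fixes a :: "'m::finite \<Rightarrow> 'n::finite" and c :: "'m \<Rightarrow> 's"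
  shows "rank (class_state a c) = card (range c)"
proof -
  define u :: "'s \<Rightarrow> complex^('n \<times> 'm)" where
    "u s = (\<chi> q. if fst q = a (snd q) \<and> c (snd q) = s then 1 / of_nat CARD('m) else 0)" for s
  have u_at: "u s $ (a j, j) = (if c j = s then 1 / of_nat CARD('m) else 0)" for s j
    by (simp add: u_def)
  have inj: "inj_on u (range c)"
  proof (rule inj_onI, clarify)
    fix j l assume "u (c j) = u (c l)"
    then have "u (c j) $ (a j, j) = u (c l) $ (a j, j)" by simp
    then show "c j = c l"
      by (simp add: u_at split: if_splits)
  qed
  have row: "row p (class_state a c) = (if fst p = a (snd p) then u (c (snd p)) else 0)" for p
    by (auto simp: row_def class_state_def u_def vec_eq_iff)
  show ?thesis
    unfolding row_rank_def_gen
  proof (rule vec.dim_unique)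
    have "u (c j) = row (a j, j) (class_state a c)" for j
      by (simp add: row)
    then show "u ` range c \<subseteq> rows (class_state a c)"
      unfolding rows_def by blast
    show "rows (class_state a c) \<subseteq> vec.span (u ` range c)"
      by (auto simp: rows_def row intro: vec.span_base vec.span_zero)
    show "vec.independent (u ` range c)"
    proof (rule vec.independent_if_scalars_zero)
      fix f x assume sum: "(\<Sum>x\<in>u ` range c. f x *s x) = 0" and "x \<in> u ` range c"
      then obtain j where x: "x = u (c j)" by blast
      \<comment> \<open>Among the vectors \<open>u s\<close> only \<open>u (c j)\<close> is nonzero
        at the coordinate \<open>(a j, j)\<close>, so this coordinate isolates the coefficient of
        \<open>x\<close>.\<close>
      have "0 = (\<Sum>s\<in>range c. f (u s) *s u s) $ (a j, j)"
        using sum by (simp add: sum.reindex [OF inj])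
      also have "\<dots> = (\<Sum>s\<in>range c. if c j = s then f (u s) / of_nat CARD('m) else 0)"
        unfolding sum_component by (intro sum.cong) (auto simp: u_at)
      also have "\<dots> = f x / of_nat CARD('m)"
        by (simp add: x)
      finally show "f x = 0"
        by simp
    qed simp
    show "card (u ` range c) = card (range c)"
      by (rule card_image [OF inj])
  qed
qed

section \<open>Quotients, remainders and the choice of labels\<close>

text \<open>The fibre is the interval from \<open>y * d\<close> up to but excluding
  \<open>Suc y * d\<close>; \<open>y < n\<close> keeps all of it below \<open>n * d\<close>.\<close>

lemma card_div_fibre:
  fixes d n y :: nat
  assumes "0 < d" "y < n"
  shows "card {x. x < n * d \<and> x div d = y} = d"
proof -
  have div_eq_iff: "x div d = y \<longleftrightarrow> y * d \<le> x \<and> x < Suc y * d" for x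
  proof -
    have "x div d = y \<longleftrightarrow> y \<le> x div d \<and> x div d < Suc y"
      by auto
    then show ?thesis
      using \<open>0 < d\<close> by (simp only: less_eq_div_iff_mult_less_eq div_less_iff_less_mult)
  qed
  have "Suc y * d \<le> n * d"
    using \<open>y < n\<close> by (intro mult_le_mono1) simp
  then have "{x. x < n * d \<and> x div d = y} = {y * d..<Suc y * d}"
    unfolding div_eq_iff by (auto simp only: set_eq_iff mem_Collect_eq atLeastLessThan_iff intro: less_le_trans)
  then show ?thesis
    by simp
qed

text \<open>Equal quotients put both numbers in one block of length \<open>d\<close>, so they differ
  by less than \<open>d \<le> k\<close>, while \<open>k\<close> divides the difference.\<close>

lemma div_mod_eqD:
  fixes x y d k :: nat
  assumes "0 < d" "d \<le> k" "x div d = y div d" "x mod k = y mod k"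
  shows "x = y"
proof -
  \<comment> \<open>The ordered case comes first because subtraction on \<open>nat\<close>
    truncates.\<close>
  have *: "x = y" if "x \<le> y" "x div d = y div d" "x mod k = y mod k" for x y
  proof -
    have "y - x < d"
      using div_times_less_eq_dividend [of x d] dividend_less_div_times [OF \<open>0 < d\<close>, of y]
      unfolding that(2) less_diff_conv2 [OF that(1)] by linarith
    moreover have "k dvd y - x"
      using that by (metis mod_eq_dvd_iff_nat)
    ultimately show ?thesis
      using that(1) \<open>d \<le> k\<close> by (auto dest: dvd_imp_le)
  qed
  show ?thesis
    using * [of x y] * [of y x] assms by (cases "x \<le> y") auto
qed

lemma equitable_labelling_exists:
  assumes m: "CARD('m::finite) = CARD('n::finite) * d" and "d \<le> k" "k \<le> CARD('m)"
  obtains a :: "'m::finite \<Rightarrow> 'n::finite" and c :: "'m \<Rightarrow> nat"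
  where "\<And>i. CARD('n) * card {j. a j = i} = CARD('m)" "inj (\<lambda>j. (a j, c j))" "card (range c) = k"
proof -
  have "0 < d"
    using m by (metis mult_0_right neq0_conv zero_less_card_finite)
  obtain e :: "'m \<Rightarrow> nat" where e: "bij_betw e UNIV {0..<CARD('m)}"
    using ex_bij_betw_finite_nat [of "UNIV :: 'm set"] by auto
  obtain g :: "nat \<Rightarrow> 'n" where g: "bij_betw g {0..<CARD('n)} UNIV"
    using ex_bij_betw_nat_finite [of "UNIV :: 'n set"] by auto
  have inj_e: "inj e" and range_e: "range e = {0..<CARD('m)}"
    using e by (auto simp: bij_betw_def)
  have e_div: "e j div d < CARD('n)" for j
  proof -
    have "e j < CARD('n) * d"
      using range_e m by (metis atLeastLessThan_iff rangeI)
    then show ?thesis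
      using \<open>0 < d\<close> by (simp add: div_less_iff_less_mult)
  qed
  have g_eq: "g x = g y \<longleftrightarrow> x = y" if "x < CARD('n)" "y < CARD('n)" for x y
    using g that by (auto simp: bij_betw_def inj_on_def)
  define a where "a j = g (e j div d)" for j
  define c where "c j = e j mod k" for j
  have "card {j. a j = i} = d" for i
  proof -
    obtain y where y: "y < CARD('n)" "i = g y"
      using g by (metis atLeastLessThan_iff bij_betw_def imageE UNIV_I)
    \<comment> \<open>The fibre is counted through its image under the numbering \<open>e\<close>,
      where it becomes a fibre of \<open>div\<close>.\<close>
    have "e ` {j. a j = i} = {x \<in> range e. x div d = y}"
      using y by (auto simp: a_def g_eq e_div)
    also have "\<dots> = {x. x < CARD('n) * d \<and> x div d = y}"
      by (auto simp: range_e m)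
    finally have "card (e ` {j. a j = i}) = d"
      using card_div_fibre [OF \<open>0 < d\<close> y(1)] by simp
    then show ?thesis
      using card_image [OF inj_on_subset [OF inj_e]] by (metis subset_UNIV)
  qed
  moreover have "inj (\<lambda>j. (a j, c j))"
  proof (rule injI)
    fix j l assume "(a j, c j) = (a l, c l)"
    then have "g (e j div d) = g (e l div d)" and mod_eq: "e j mod k = e l mod k"
      by (simp_all add: a_def c_def)
    then have "e j div d = e l div d"
      using g_eq e_div by blast
    then have "e j = e l"
      using div_mod_eqD \<open>0 < d\<close> \<open>d \<le> k\<close> mod_eq by blast
    then show "j = l"
      using inj_e by (simp add: inj_eq)
  qed
  moreover have "card (range c) = k"
  proof -
    have "range c = (\<lambda>x. x mod k) ` {0..<CARD('m)}"
      unfolding range_e [symmetric] image_image c_def ..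
    also have "\<dots> = {0..<k}"
    proof
      show "(\<lambda>x. x mod k) ` {0..<CARD('m)} \<subseteq> {0..<k}"
        using \<open>0 < d\<close> \<open>d \<le> k\<close> by auto
      \<comment> \<open>Each \<open>x < k\<close> is its own remainder and, as
        \<open>k \<le> m\<close>, one of the numbers used.\<close>
      show "{0..<k} \<subseteq> (\<lambda>x. x mod k) ` {0..<CARD('m)}"
      proof
        fix x assume "x \<in> {0..<k}"
        then show "x \<in> (\<lambda>x. x mod k) ` {0..<CARD('m)}"
          using \<open>k \<le> CARD('m)\<close> by (intro image_eqI [where x = x]) auto
      qed
    qed
    finally show ?thesis
      by simp
  qed
  ultimately show thesis
    by (intro that) (simp_all add: m)
qed

theorem theorem4p3:
  fixes k :: int
  assumes "CARD('n::finite) \<le> CARD('m::finite)"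
    and "CARD('n) dvd CARD('m)"
    and "real CARD('m) / real CARD('n) \<le> real_of_int k"
    and "k \<le> int CARD('m)"
  shows "\<exists>\<rho> \<in> couplings (maximally_mixed :: complex^'n^'n) (maximally_mixed :: complex^'m^'m).
           int (rank \<rho>) = k"
proof -
  obtain d where d: "CARD('m) = CARD('n) * d"
    using assms(2) by (elim dvdE)
  then have "real d \<le> real_of_int k"
    using assms(3) by simp
  \<comment> \<open>Since m/n is \<open>d\<close>, the lower bound makes \<open>k\<close>
    nonnegative, so \<open>nat k\<close> loses nothing.\<close>
  then have k: "d \<le> nat k" "nat k \<le> CARD('m)" "int (nat k) = k"
    using assms(4) by linarith+
  obtain a :: "'m \<Rightarrow> 'n" and c :: "'m \<Rightarrow> nat"
    where "\<And>i. CARD('n) * card {j. a j = i} = CARD('m)" "inj (\<lambda>j. (a j, c j))"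
      and rank: "card (range c) = nat k"
    using equitable_labelling_exists [OF d k(1,2)] by metis
  then have "class_state a c \<in> couplings maximally_mixed maximally_mixed"
    by (simp add: couplings_def density_operator_def positive_semidefinite_class_state
        trace_class_state partial_trace_A_class_state partial_trace_B_class_state)
  moreover have "int (rank (class_state a c)) = k"
    by (simp only: rank_class_state rank k(3))
  ultimately show ?thesis
    by blast
qed

end
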